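(* Let $\kappa$ be any uncountable cardinal. There is a $T_1$ first-countable topological space $X$ such that $|X|=\kappa$ and player two has a winning strategy in the game $G^\omega_1(\mathcal{C}_X,\mathcal{D}_X)$.
   Context: For an ordinal $\alpha$ and collections of sets $\mathcal{A},\mathcal{B}$, $G^\alpha_1(\mathcal{A},\mathcal{B})$ denotes the two-player game of length $\alpha$ in which, at inning $\beta<\alpha$, player one chooses $\mathcal{U}_\beta\in\mathcal{A}$ and player two responds with an element $V_\beta\in\mathcal{U}_\beta$. Player two wins if and only if $\{V_\beta:\beta<\alpha\}\in\mathcal{B}$. For a topological space $X$: $\mathcal{C}_X$ is the collection of all maximal families of pairwise disjoint non-empty open subsets of $X$, and $\mathcal{D}_X$ is the collection of all families $\mathcal{U}$ of open subsets of $X$ such that $\bigcup\mathcal{U}$ is dense in $X$. *)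

theory Defs
  imports "HOL-Analysis.Analysis"
begin

unbundle cardinal_syntax

text \<open>
  The length of a game is an ordinal given as a well-order relation \<open>\<alpha>\<close>; the innings are the
  elements of \<open>Field \<alpha>\<close>. A strategy of player two maps an inning \<open>\<beta>\<close> and the moves
  \<open>(U \<gamma>)\<close>, \<open>\<gamma> \<le> \<beta>\<close>, made so far by player one (a function that is \<open>undefined\<close> outside
  \<open>under \<alpha> \<beta>\<close>) to player two's move in that inning. The earlier moves of player two need not be
  arguments, since they are determined by the strategy itself.
\<close>

definition response ::
  "'i rel \<Rightarrow> ('i \<Rightarrow> ('i \<Rightarrow> 'm set) \<Rightarrow> 'm) \<Rightarrow> ('i \<Rightarrow> 'm set) \<Rightarrow> 'i \<Rightarrow> 'm" where
  "response \<alpha> \<sigma> U \<beta> = \<sigma> \<beta> (restrict U (under \<alpha> \<beta>))"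

definition G1_winning_strategy_two ::
  "'i rel \<Rightarrow> 'm set set \<Rightarrow> 'm set set \<Rightarrow> ('i \<Rightarrow> ('i \<Rightarrow> 'm set) \<Rightarrow> 'm) \<Rightarrow> bool" where
  "G1_winning_strategy_two \<alpha> \<A> \<B> \<sigma> \<longleftrightarrow>
     (\<forall>U. (\<forall>\<beta>\<in>Field \<alpha>. U \<beta> \<in> \<A>) \<longrightarrow>
        (\<forall>\<beta>\<in>Field \<alpha>. response \<alpha> \<sigma> U \<beta> \<in> U \<beta>) \<and>
        response \<alpha> \<sigma> U ` Field \<alpha> \<in> \<B>)"

definition disjoint_open_family :: "'a topology \<Rightarrow> 'a set set \<Rightarrow> bool" where
  "disjoint_open_family X \<U> \<longleftrightarrow> (\<forall>U\<in>\<U>. openin X U \<and> U \<noteq> {}) \<and> pairwise disjnt \<U>"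

definition max_disjoint_open_families :: "'a topology \<Rightarrow> 'a set set set" where
  "max_disjoint_open_families X =
     {\<U>. disjoint_open_family X \<U> \<and>
          (\<forall>\<V>. disjoint_open_family X \<V> \<and> \<U> \<subseteq> \<V> \<longrightarrow> \<V> = \<U>)}"

definition open_families_dense_union :: "'a topology \<Rightarrow> 'a set set set" where
  "open_families_dense_union X =
     {\<U>. (\<forall>U\<in>\<U>. openin X U) \<and> X closure_of (\<Union>\<U>) = topspace X}"

end

theory Submission
  imports Defs
begin

text \<open>
  A countable \<open>\<pi>\<close>-base \<open>B\<^sub>0, B\<^sub>1, \<dots>\<close> (nonempty open sets, one of them inside each nonempty open
  set) makes the game easy for player two. A maximal family of pairwise disjoint nonempty open
  sets has a member meeting \<open>B\<^sub>n\<close>, for otherwise \<open>B\<^sub>n\<close> could be added to it. Choosing such a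
  member in inning \<open>n\<close>, player two produces a union that meets every \<open>B\<^sub>n\<close> and hence every
  nonempty open set.

  It remains to find first-countable \<open>T\<^sub>1\<close> spaces of arbitrarily large size with a countable
  \<open>\<pi>\<close>-base. No separation beyond \<open>T\<^sub>1\<close> being required, the points outside a fixed countable set
  may all share their punctured neighbourhoods: let \<open>D\<close> be a countably infinite subset of a set \<open>S\<close>, let
  the points of \<open>D\<close> be isolated, and let the basic neighbourhoods of \<open>x \<in> S - D\<close> be the sets
  \<open>{x} \<union> (D - F)\<close> with \<open>F\<close> finite. The singletons \<open>{d}\<close>, \<open>d \<in> D\<close>, form a countable \<open>\<pi>\<close>-base.
\<close>

lemma maximal_disjoint_family_meets_open:
  assumes "\<U> \<in> max_disjoint_open_families X" and "openin X B" and "B \<noteq> {}"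
  shows "\<exists>V\<in>\<U>. V \<inter> B \<noteq> {}"
proof (rule ccontr)
  assume "\<not> ?thesis"
  then have disj: "\<forall>V\<in>\<U>. V \<inter> B = {}" by blast
  have "disjoint_open_family X \<U>"
    using assms(1) by (simp add: max_disjoint_open_families_def)
  with disj assms have "disjoint_open_family X (insert B \<U>)"
    unfolding disjoint_open_family_def pairwise_insert by (auto simp: disjnt_def)
  then have "insert B \<U> = \<U>"
    using assms(1) unfolding max_disjoint_open_families_def by blast
  with disj assms(3) show False by blast
qed

lemma winning_strategy_two_if_countable_pi_base:
  fixes B :: "nat \<Rightarrow> 'a set"
  assumes B: "\<And>n. openin X (B n)" "\<And>n. B n \<noteq> {}"
    and pi_base: "\<And>W. openin X W \<Longrightarrow> W \<noteq> {} \<Longrightarrow> \<exists>n. B n \<subseteq> W"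
  shows "\<exists>\<sigma>. G1_winning_strategy_two natLeq
           (max_disjoint_open_families X) (open_families_dense_union X) \<sigma>"
proof -
  define \<sigma> where "\<sigma> n u = (SOME V. V \<in> u n \<and> V \<inter> B n \<noteq> {})" for n and u :: "nat \<Rightarrow> 'a set set"
  have "G1_winning_strategy_two natLeq
          (max_disjoint_open_families X) (open_families_dense_union X) \<sigma>"
    unfolding G1_winning_strategy_two_def
  proof (intro allI impI)
    fix U assume "\<forall>n\<in>Field natLeq. U n \<in> max_disjoint_open_families X"
    then have U: "U n \<in> max_disjoint_open_families X" for n
      by (simp add: Field_natLeq)
    let ?r = "response natLeq \<sigma> U"
    have r: "?r n \<in> U n \<and> ?r n \<inter> B n \<noteq> {}" for n
    proof -
      have "?r n = (SOME V. V \<in> U n \<and> V \<inter> B n \<noteq> {})"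
        by (simp add: response_def \<sigma>_def under_def natLeq_def)
      moreover have "\<exists>V. V \<in> U n \<and> V \<inter> B n \<noteq> {}"
        using maximal_disjoint_family_meets_open[OF U B] by blast
      ultimately show ?thesis by (metis (mono_tags, lifting) someI_ex)
    qed
    have r_open: "openin X (?r n)" for n
      using r[of n] U[of n]
      unfolding max_disjoint_open_families_def disjoint_open_family_def by blast
    have "X closure_of (\<Union>(range ?r)) = topspace X"
      unfolding dense_intersects_open
    proof (intro allI impI)
      fix W assume "openin X W \<and> W \<noteq> {}"
      then obtain n where "B n \<subseteq> W" using pi_base by blast
      then show "\<Union>(range ?r) \<inter> W \<noteq> {}" using r[of n] by blast
    qed
    then show "(\<forall>n\<in>Field natLeq. ?r n \<in> U n) \<and>
        ?r ` Field natLeq \<in> open_families_dense_union X"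
      using r r_open by (auto simp: Field_natLeq open_families_dense_union_def)
  qed
  then show ?thesis by blast
qed

text \<open>The finiteness condition is the same for all points of \<open>S - D\<close>, so it is imposed once on
  the open set instead of at each of its points: this is the topology generated by the basic
  neighbourhoods \<open>{d}\<close> and \<open>{x} \<union> (D - F)\<close> described above.\<close>
definition common_tail_topology :: "'a set \<Rightarrow> 'a set \<Rightarrow> 'a topology" where
  "common_tail_topology S D = topology (\<lambda>U. U \<subseteq> S \<and> (U \<subseteq> D \<or> finite (D - U)))"

lemma openin_common_tail_topology:
  "openin (common_tail_topology S D) U \<longleftrightarrow> U \<subseteq> S \<and> (U \<subseteq> D \<or> finite (D - U))"
proof -
  have "istopology (\<lambda>U. U \<subseteq> S \<and> (U \<subseteq> D \<or> finite (D - U)))"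
    unfolding istopology_def
  proof (intro conjI allI impI)
    fix U V
    assume "U \<subseteq> S \<and> (U \<subseteq> D \<or> finite (D - U))" and "V \<subseteq> S \<and> (V \<subseteq> D \<or> finite (D - V))"
    then show "U \<inter> V \<subseteq> S" and "U \<inter> V \<subseteq> D \<or> finite (D - U \<inter> V)"
      by (auto simp: Diff_Int)
  next
    fix \<K> assume \<K>: "\<forall>K\<in>\<K>. K \<subseteq> S \<and> (K \<subseteq> D \<or> finite (D - K))"
    then show "\<Union>\<K> \<subseteq> S" by blast
    show "\<Union>\<K> \<subseteq> D \<or> finite (D - \<Union>\<K>)"
    proof (cases "\<Union>\<K> \<subseteq> D")
      case False
      then obtain K where "K \<in> \<K>" and "\<not> K \<subseteq> D" by blast
      with \<K> have "finite (D - K)" by blast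
      then have "finite (D - \<Union>\<K>)"
        using \<open>K \<in> \<K>\<close> by (rule_tac finite_subset[of _ "D - K"]) auto
      then show ?thesis ..
    qed simp
  qed
  then show ?thesis by (simp add: common_tail_topology_def topology_inverse')
qed

lemma topspace_common_tail_topology:
  assumes "D \<subseteq> S"
  shows "topspace (common_tail_topology S D) = S"
proof (rule antisym)
  show "topspace (common_tail_topology S D) \<subseteq> S"
    using openin_topspace[of "common_tail_topology S D"]
    unfolding openin_common_tail_topology by (rule conjunct1)
  have "D - S = {}" using assms by blast
  then have "openin (common_tail_topology S D) S"
    unfolding openin_common_tail_topology by (metis finite.emptyI order_refl)
  then show "S \<subseteq> topspace (common_tail_topology S D)" by (rule openin_subset)
qed

lemma t1_space_common_tail_topology:
  assumes "D \<subseteq> S"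
  shows "t1_space (common_tail_topology S D)"
  unfolding t1_space_def topspace_common_tail_topology[OF assms]
proof (intro ballI impI)
  fix x y assume "x \<in> S" "y \<in> S" "x \<noteq> y"
  moreover have "openin (common_tail_topology S D) (insert x (D - {y}))"
  proof -
    have "D - insert x (D - {y}) \<subseteq> {y}" by blast
    then have "finite (D - insert x (D - {y}))" by (rule finite_subset) simp
    then show ?thesis
      using assms \<open>x \<in> S\<close> by (auto simp: openin_common_tail_topology)
  qed
  ultimately show "\<exists>U. openin (common_tail_topology S D) U \<and> x \<in> U \<and> y \<notin> U" by blast
qed

text \<open>A countable set has only countably many finite subsets \<open>F\<close>, so each point outside \<open>D\<close> has
  only countably many basic neighbourhoods.\<close>
lemma first_countable_common_tail_topology:
  assumes "D \<subseteq> S" and "countable D"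
  shows "first_countable (common_tail_topology S D)"
  unfolding first_countable_def topspace_common_tail_topology[OF assms(1)]
proof
  fix x assume "x \<in> S"
  define \<B> where
    "\<B> = (if x \<in> D then {{x}} else (\<lambda>F. insert x (D - F)) ` {F. finite F \<and> F \<subseteq> D})"
  have "countable \<B>"
    using assms(2) by (simp add: \<B>_def countable_Collect_finite_subset)
  moreover have "openin (common_tail_topology S D) V" if "V \<in> \<B>" for V
  proof (cases "x \<in> D")
    case True
    with that \<open>x \<in> S\<close> show ?thesis by (simp add: \<B>_def openin_common_tail_topology)
  next
    case False
    with that obtain F where F: "finite F" "V = insert x (D - F)" by (auto simp: \<B>_def)
    then have "D - V \<subseteq> F" by blast
    then have "finite (D - V)" using F(1) by (rule finite_subset)
    then show ?thesis
      using F(2) assms(1) \<open>x \<in> S\<close> by (auto simp: openin_common_tail_topology)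
  qed
  moreover have "\<exists>V\<in>\<B>. x \<in> V \<and> V \<subseteq> U" if U: "openin (common_tail_topology S D) U" "x \<in> U" for U
  proof (cases "x \<in> D")
    case True
    with U(2) show ?thesis by (simp add: \<B>_def)
  next
    case False
    with U have "finite (D - U)" by (auto simp: openin_common_tail_topology)
    then have "insert x (D - (D - U)) \<in> \<B>" using False by (simp add: \<B>_def)
    moreover have "insert x (D - (D - U)) \<subseteq> U" using U(2) by auto
    ultimately show ?thesis by (rule_tac bexI[of _ "insert x (D - (D - U))"]) simp_all
  qed
  ultimately
  show "\<exists>\<B>. countable \<B> \<and> (\<forall>V\<in>\<B>. openin (common_tail_topology S D) V) \<and>
      (\<forall>U. openin (common_tail_topology S D) U \<and> x \<in> U \<longrightarrow> (\<exists>V\<in>\<B>. x \<in> V \<and> V \<subseteq> U))"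
    by (intro exI[of _ \<B>]) simp
qed

lemma open_meets_dense_part_common_tail_topology:
  assumes "infinite D" and "openin (common_tail_topology S D) U" and "U \<noteq> {}"
  shows "U \<inter> D \<noteq> {}"
proof
  assume *: "U \<inter> D = {}"
  then have "D - U = D" by blast
  with * assms show False by (auto simp: openin_common_tail_topology)
qed

theorem mainTheorem7:
  fixes \<kappa> :: "'a rel"
  assumes "Card_order \<kappa>" and "natLeq <o \<kappa>"
  shows "\<exists>X :: 'a topology. t1_space X \<and> first_countable X \<and> |topspace X| =o \<kappa> \<and>
           (\<exists>\<sigma>. G1_winning_strategy_two natLeq
                  (max_disjoint_open_families X) (open_families_dense_union X) \<sigma>)"
proof -
  let ?S = "Field \<kappa>"
  have "natLeq \<le>o |?S|"
    using ordLess_imp_ordLeq[OF assms(2)] ordIso_symmetric[OF card_of_Field_ordIso[OF assms(1)]]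
    by (rule ordLeq_ordIso_trans)
  then have "infinite ?S" using infinite_iff_natLeq_ordLeq by blast
  then obtain d :: "nat \<Rightarrow> 'a" where d: "inj d" "range d \<subseteq> ?S"
    using infinite_countable_subset by blast
  let ?X = "common_tail_topology ?S (range d)"
  have "\<exists>\<sigma>. G1_winning_strategy_two natLeq
          (max_disjoint_open_families ?X) (open_families_dense_union ?X) \<sigma>"
  proof (rule winning_strategy_two_if_countable_pi_base)
    show "openin ?X {d n}" for n
      using d(2) by (auto simp: openin_common_tail_topology)
    show "\<exists>n. {d n} \<subseteq> W" if "openin ?X W" "W \<noteq> {}" for W
      using open_meets_dense_part_common_tail_topology[OF range_inj_infinite[OF d(1)] that] by blast
  qed simp
  moreover have "|topspace ?X| =o \<kappa>"
    using assms(1) d(2) by (simp add: topspace_common_tail_topology card_of_Field_ordIso)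
  ultimately show ?thesis
    using t1_space_common_tail_topology[OF d(2)] first_countable_common_tail_topology[OF d(2)]
    by blast
qed

end
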